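(* Let $(X,d)$ be an ultrametric space. Then the set $\bar{\mathbf{B}}_X^0$ is the unique dense discrete subset of the ultrametric space $(\bar{\mathbf{B}}_X, d_H)$; that is, $\bar{\mathbf{B}}_X^0$ is a dense discrete subset of $(\bar{\mathbf{B}}_X, d_H)$, and every dense discrete subset of $(\bar{\mathbf{B}}_X, d_H)$ equals $\bar{\mathbf{B}}_X^0$.
   Context: Metric spaces are nonempty. An ultrametric space is a metric space $(X,d)$ with $d(x,y)\le\max\{d(x,z),d(z,y)\}$ for all $x,y,z\in X$. For $c\in X$ and $r\ge 0$ the closed ball is $\bar B_r(c)=\{x\in X: d(c,x)\le r\}$ (so $\bar B_0(c)=\{c\}$). $\bar{\mathbf{B}}_X$ is the set of all closed balls $\bar B_r(c)$, $c\in X$, $r\ge 0$, regarded as subsets of $X$, and $\bar{\mathbf{B}}_X^0$ is the set of all subsets of $X$ that can be written as $\bar B_r(c)$ with $c\in X$ and $r>0$. The Hausdorff distance between nonempty closed bounded sets $A,B\subseteq X$ is $d_H(A,B)=\max\{\sup_{a\in A}\inf_{b\in B}d(a,b),\ \sup_{b\in B}\inf_{a\in A}d(a,b)\}$; $\bar{\mathbf{B}}_X$ is equipped with the metric $d_H$ (which is an ultrametric on it). A subset $S$ of a metric space $Y$ is dense if every point of $Y$ is the limit of a sequence of points of $S$. A subset $S$ of a metric space $Y$ is discrete if for every $s\in S$ there is $r>0$ such that the closed ball of radius $r$ in $Y$ centered at $s$ meets $S$ only in $s$. *)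

theory Defs
  imports "HOL-Analysis.Analysis"
begin

context Metric_space
begin

definition closed_balls :: "'a set set" where
  "closed_balls = {mcball c r |c r. c \<in> M \<and> 0 \<le> r}"

definition closed_balls_pos :: "'a set set" where
  "closed_balls_pos = {mcball c r |c r. c \<in> M \<and> 0 < r}"

definition closed_bounded_sets :: "'a set set" where
  "closed_bounded_sets = {A. A \<noteq> {} \<and> closedin mtopology A \<and> mbounded A}"

text \<open>The Hausdorff distance is only meaningful on nonempty closed bounded sets. Outside this
  domain it is set to 0, since the locale \<^locale>\<open>Metric_space\<close> requires a distance function to be
  nonnegative and symmetric on the whole type.\<close>

definition hausdorff_dist :: "'a set \<Rightarrow> 'a set \<Rightarrow> real" where
  "hausdorff_dist A B =
     (if A \<in> closed_bounded_sets \<and> B \<in> closed_bounded_sets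
      then max (SUP a\<in>A. INF b\<in>B. d a b) (SUP b\<in>B. INF a\<in>A. d a b)
      else 0)"

definition dense_subset :: "'a set \<Rightarrow> bool" where
  "dense_subset S \<longleftrightarrow>
     S \<subseteq> M \<and> (\<forall>x\<in>M. \<exists>s. (\<forall>n::nat. s n \<in> S) \<and> limitin mtopology s x sequentially)"

definition discrete_subset :: "'a set \<Rightarrow> bool" where
  "discrete_subset S \<longleftrightarrow> S \<subseteq> M \<and> (\<forall>s\<in>S. \<exists>r>0. mcball s r \<inter> S = {s})"

lemma closed_balls_subset: "closed_balls \<subseteq> closed_bounded_sets"
  by (auto simp: closed_balls_def closed_bounded_sets_def mbounded_mcball)

lemma INF_dist_le_iff:
  assumes "B \<noteq> {}"
  shows "(INF b\<in>B. d a b) \<le> r \<longleftrightarrow> (\<forall>e>r. \<exists>b\<in>B. d a b < e)"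
proof -
  have bdd: "bdd_below (d a ` B)"
    by (rule bdd_belowI2[where m = 0]) simp
  show ?thesis
  proof
    assume "(INF b\<in>B. d a b) \<le> r"
    then show "\<forall>e>r. \<exists>b\<in>B. d a b < e"
      using cINF_less_iff[OF assms bdd] by (meson le_less_trans)
  next
    assume *: "\<forall>e>r. \<exists>b\<in>B. d a b < e"
    show "(INF b\<in>B. d a b) \<le> r"
    proof (rule dense_ge)
      fix e assume "r < e"
      then have "(INF b\<in>B. d a b) < e"
        using * cINF_less_iff[OF assms bdd] by simp
      then show "(INF b\<in>B. d a b) \<le> e"
        by simp
    qed
  qed
qed

lemma bdd_above_INF_dist:
  assumes "A \<in> closed_bounded_sets" "B \<in> closed_bounded_sets"
  shows "bdd_above ((\<lambda>a. INF b\<in>B. d a b) ` A)"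
proof -
  have "mbounded (A \<union> B)"
    using assms by (auto simp: closed_bounded_sets_def mbounded_Un)
  then obtain C where C: "\<forall>x\<in>A \<union> B. \<forall>y\<in>A \<union> B. d x y \<le> C"
    by (auto simp: mbounded_alt)
  obtain b where b: "b \<in> B"
    using assms by (auto simp: closed_bounded_sets_def)
  have "(INF b\<in>B. d a b) \<le> C" if "a \<in> A" for a
    by (rule cINF_lower2[OF _ b]) (use that b C in \<open>auto intro!: bdd_belowI2[where m = 0]\<close>)
  then show ?thesis
    by (rule bdd_aboveI2)
qed

lemma hausdorff_dist_le_iff:
  assumes "A \<in> closed_bounded_sets" "B \<in> closed_bounded_sets"
  shows "hausdorff_dist A B \<le> r \<longleftrightarrow>
    (\<forall>a\<in>A. \<forall>e>r. \<exists>b\<in>B. d a b < e) \<and> (\<forall>b\<in>B. \<forall>e>r. \<exists>a\<in>A. d b a < e)"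
proof -
  have ne: "A \<noteq> {}" "B \<noteq> {}"
    using assms by (auto simp: closed_bounded_sets_def)
  have "(SUP b\<in>B. INF a\<in>A. d a b) = (SUP b\<in>B. INF a\<in>A. d b a)"
    by (intro SUP_cong INF_cong refl commute)
  then show ?thesis
    using assms ne
    by (simp add: hausdorff_dist_def cSUP_le_iff bdd_above_INF_dist INF_dist_le_iff)
qed

lemma hausdorff_dist_commute: "hausdorff_dist A B = hausdorff_dist B A"
proof -
  have swap: "(INF b\<in>B. d a b) = (INF b\<in>B. d b a)" for a B
    by (rule INF_cong) (simp_all add: commute)
  show ?thesis
    by (simp only: hausdorff_dist_def swap max.commute conj_commute)
qed

lemma hausdorff_dist_nonneg: "0 \<le> hausdorff_dist A B"
proof (cases "A \<in> closed_bounded_sets \<and> B \<in> closed_bounded_sets")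
  case True
  then obtain a where "a \<in> A"
    by (auto simp: closed_bounded_sets_def)
  show ?thesis
  proof (rule ccontr)
    assume "\<not> ?thesis"
    then have neg: "hausdorff_dist A B < 0"
      by simp
    obtain b where "d a b < 0"
      using hausdorff_dist_le_iff[of A B "hausdorff_dist A B"] True \<open>a \<in> A\<close> neg by blast
    then show False
      using nonneg[of a b] by simp
  qed
qed (auto simp: hausdorff_dist_def)

lemma hausdorff_dist_eq_0_imp_subset:
  assumes A: "A \<in> closed_bounded_sets" and B: "B \<in> closed_bounded_sets"
    and le: "hausdorff_dist A B \<le> 0"
  shows "A \<subseteq> B"
proof
  fix a assume a: "a \<in> A"
  have sub: "A \<subseteq> M" "B \<subseteq> M"
    using A B by (auto simp: closed_bounded_sets_def mbounded_alt)
  have "\<exists>b\<in>B. b \<in> mball a e" if e: "e > 0" for e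
  proof -
    obtain b where "b \<in> B" "d a b < e"
      using hausdorff_dist_le_iff[OF A B, of 0] le a e by blast
    then show ?thesis
      using a sub by auto
  qed
  then have "a \<in> mtopology closure_of B"
    using a sub unfolding metric_closure_of by blast
  then show "a \<in> B"
    using B by (auto simp: closed_bounded_sets_def closure_of_closedin)
qed

end

locale ultrametric_space = Metric_space +
  assumes nonempty: "M \<noteq> {}"
    and ultrametric: "\<And>x y z. \<lbrakk>x \<in> M; y \<in> M; z \<in> M\<rbrakk> \<Longrightarrow> d x y \<le> max (d x z) (d z y)"
begin

lemma hausdorff_dist_ultra:
  assumes A: "A \<in> closed_bounded_sets" and B: "B \<in> closed_bounded_sets"
    and C: "C \<in> closed_bounded_sets"
  shows "hausdorff_dist A B \<le> max (hausdorff_dist A C) (hausdorff_dist C B)" (is "_ \<le> ?m")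
proof -
  have sub: "A \<subseteq> M" "B \<subseteq> M" "C \<subseteq> M"
    using A B C by (auto simp: closed_bounded_sets_def mbounded_alt)
  have AC: "(\<forall>a\<in>A. \<forall>e>?m. \<exists>c\<in>C. d a c < e) \<and> (\<forall>c\<in>C. \<forall>e>?m. \<exists>a\<in>A. d c a < e)"
    using hausdorff_dist_le_iff[OF A C, of ?m] by simp
  have CB: "(\<forall>c\<in>C. \<forall>e>?m. \<exists>b\<in>B. d c b < e) \<and> (\<forall>b\<in>B. \<forall>e>?m. \<exists>c\<in>C. d b c < e)"
    using hausdorff_dist_le_iff[OF C B, of ?m] by simp
  have ul: "d x y < e" if "d x z < e" "d z y < e" "x \<in> M" "y \<in> M" "z \<in> M" for x y z e
    using ultrametric[of x y z] that by simp
  show ?thesis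
    unfolding hausdorff_dist_le_iff[OF A B]
  proof (intro conjI ballI allI impI)
    fix a e assume "a \<in> A" "?m < e"
    then obtain c where c: "c \<in> C" "d a c < e" using AC by blast
    then obtain b where "b \<in> B" "d c b < e" using CB \<open>?m < e\<close> by blast
    then show "\<exists>b\<in>B. d a b < e" using ul c \<open>a \<in> A\<close> sub by blast
  next
    fix b e assume "b \<in> B" "?m < e"
    then obtain c where c: "c \<in> C" "d b c < e" using CB by blast
    then obtain a where "a \<in> A" "d c a < e" using AC \<open>?m < e\<close> by blast
    then show "\<exists>a\<in>A. d b a < e" using ul c \<open>b \<in> B\<close> sub by blast
  qed
qed

end

lemma (in ultrametric_space) ultrametric_closed_balls:
  "ultrametric_space closed_balls hausdorff_dist"
proof
  show "0 \<le> hausdorff_dist A B" for A B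
    by (rule hausdorff_dist_nonneg)
  show "hausdorff_dist A B = hausdorff_dist B A" for A B
    by (rule hausdorff_dist_commute)
  show "(hausdorff_dist A B = 0) = (A = B)" if "A \<in> closed_balls" "B \<in> closed_balls" for A B
  proof
    assume "hausdorff_dist A B = 0"
    then show "A = B"
      using that closed_balls_subset hausdorff_dist_eq_0_imp_subset[of A B]
        hausdorff_dist_eq_0_imp_subset[of B A] hausdorff_dist_commute[of A B]
      by auto
  next
    assume "A = B"
    have AM: "A \<in> closed_bounded_sets"
      using that closed_balls_subset by blast
    then have "A \<subseteq> M"
      by (auto simp: closed_bounded_sets_def mbounded_alt)
    then have "\<exists>b\<in>A. d a b < e" if "a \<in> A" "e > 0" for a e
      using that by (intro bexI[of _ a]) auto
    then have "hausdorff_dist A A \<le> 0"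
      unfolding hausdorff_dist_le_iff[OF AM AM] by blast
    then show "hausdorff_dist A B = 0"
      using hausdorff_dist_nonneg[of A A] \<open>A = B\<close> by (metis order_antisym)
  qed
  show ultra: "hausdorff_dist A B \<le> max (hausdorff_dist A C) (hausdorff_dist C B)"
    if "A \<in> closed_balls" "B \<in> closed_balls" "C \<in> closed_balls" for A B C
    using that closed_balls_subset by (intro hausdorff_dist_ultra) auto
  show "hausdorff_dist A C \<le> hausdorff_dist A B + hausdorff_dist B C"
    if "A \<in> closed_balls" "B \<in> closed_balls" "C \<in> closed_balls" for A B C
    using ultra[of A C B] that hausdorff_dist_nonneg[of A B] hausdorff_dist_nonneg[of B C] by linarith
  show "closed_balls \<noteq> {}"
    using nonempty by (auto simp: closed_balls_def)
qed

end

(* Every closed ball B of positive radius r is an isolated point of the space of closed balls. Let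
   e \<le> r be positive and, unless B is a singleton, at most the distance of some two points of B.
   If a closed ball B' has Hausdorff distance less than e from B, then B' lies in B since e \<le> r.
   If B is a singleton, then B' = B. Otherwise B' contains two points at distance at least e, so its
   radius is at least e and B lies in B'. Moreover every singleton {c} is the limit of the balls of
   radius 1/n around c. In any metric space, a dense set of isolated points is the only dense
   discrete set. *)

theory Submission
  imports Defs
begin

context Metric_space
begin

lemma dense_subset_approx:
  assumes "dense_subset S" "x \<in> M" "0 < r"
  obtains s where "s \<in> S" "d x s < r"
proof -
  obtain s :: "nat \<Rightarrow> 'a" where s: "\<And>n. s n \<in> S" "limitin mtopology s x sequentially"
    using assms unfolding dense_subset_def by blast
  then obtain n where "d (s n) x < r"
    using \<open>0 < r\<close> unfolding limitin_metric eventually_sequentially by blast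
  with s(1)[of n] that show thesis
    by (simp add: commute)
qed

text \<open>A dense set meets every ball, so it contains every point isolated in the whole space;
  this gives \<open>P \<subseteq> S\<close>. Conversely, a ball around \<open>s\<close> that
  isolates \<open>s\<close> within \<open>S\<close> meets \<open>P\<close>, and the point found
  there already lies in \<open>S\<close>, so it is \<open>s\<close>.\<close>

lemma dense_isolated_imp_unique_dense_discrete:
  assumes dense: "dense_subset P"
    and isolated: "\<And>p. p \<in> P \<Longrightarrow> \<exists>r>0. mcball p r = {p}"
  shows "discrete_subset P"
    and "\<lbrakk>dense_subset S; discrete_subset S\<rbrakk> \<Longrightarrow> S = P"
proof -
  show "discrete_subset P"
    using dense isolated unfolding dense_subset_def discrete_subset_def by fastforce
  assume S: "dense_subset S" "discrete_subset S"
  have SM: "S \<subseteq> M" and PM: "P \<subseteq> M"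
    using S dense unfolding dense_subset_def by auto
  have PS: "P \<subseteq> S"
  proof
    fix p assume p: "p \<in> P"
    then obtain r where r: "0 < r" "mcball p r = {p}"
      using isolated by blast
    obtain s where "s \<in> S" "d p s < r"
      using dense_subset_approx[OF S(1) _ r(1)] p PM by blast
    moreover from this have "s \<in> mcball p r"
      using p PM SM by auto
    ultimately show "p \<in> S"
      using r by auto
  qed
  moreover have "S \<subseteq> P"
  proof
    fix s assume s: "s \<in> S"
    then obtain r where r: "0 < r" "mcball s r \<inter> S = {s}"
      using S(2) unfolding discrete_subset_def by blast
    obtain p where "p \<in> P" "d s p < r"
      using dense_subset_approx[OF dense _ r(1)] s SM by blast
    moreover from this have "p \<in> mcball s r \<inter> S"
      using s SM PS by auto
    ultimately show "s \<in> P"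
      using r by auto
  qed
  ultimately show "S = P"
    by blast
qed

lemma closed_balls_pos_subset: "closed_balls_pos \<subseteq> closed_balls"
  unfolding closed_balls_def closed_balls_pos_def by force

text \<open>Infima need not be attained, but the strict bound leaves room:
  \<open>hausdorff_dist_le_iff\<close> is applied with the distance itself as bound.\<close>

lemma hausdorff_dist_lessD:
  assumes "A \<in> closed_bounded_sets" "B \<in> closed_bounded_sets" "hausdorff_dist A B < e" "a \<in> A"
  obtains b where "b \<in> B" "d a b < e"
  using hausdorff_dist_le_iff[OF assms(1,2), of "hausdorff_dist A B"] assms(3,4) by blast

text \<open>Every point of the larger ball is within \<open>r\<close> of \<open>c\<close>, the only
  point of \<open>mcball c 0\<close>, and \<open>c\<close> lies in both balls.\<close>

lemma hausdorff_dist_mcball_0_le: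
  assumes "c \<in> M" "0 \<le> r"
  shows "hausdorff_dist (mcball c r) (mcball c 0) \<le> r"
proof -
  have cb: "mcball c r \<in> closed_bounded_sets" "mcball c 0 \<in> closed_bounded_sets"
    using assms closed_balls_subset unfolding closed_balls_def by auto
  have "c \<in> mcball c 0" "c \<in> mcball c r"
    using assms by auto
  moreover have "d x c \<le> r" if "x \<in> mcball c r" for x
    using that by (simp add: commute)
  moreover have "x = c" if "x \<in> mcball c 0" for x
    using that nonneg[of c x] zero[of c x] by simp
  ultimately show ?thesis
    using assms unfolding hausdorff_dist_le_iff[OF cb] by (metis le_less_trans mdist_zero)
qed

end

context ultrametric_space
begin

lemma closed_balls_pos_dense:
  "Metric_space.dense_subset closed_balls hausdorff_dist closed_balls_pos"
proof -
  interpret H: ultrametric_space closed_balls hausdorff_dist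
    by (rule ultrametric_closed_balls)
  have "\<exists>s. (\<forall>n::nat. s n \<in> closed_balls_pos) \<and> limitin H.mtopology s B sequentially"
    if B: "B \<in> closed_balls" for B
  proof (cases "B \<in> closed_balls_pos")
    case True
    then show ?thesis
      using B by (intro exI[of _ "\<lambda>_. B"]) simp
  next
    case False
    \<comment> \<open>A closed ball outside \<open>closed_balls_pos\<close> can only be written with
      radius 0.\<close>
    with B obtain c where c: "c \<in> M" "B = mcball c 0"
      unfolding closed_balls_def closed_balls_pos_def by force
    let ?s = "\<lambda>n. mcball c (inverse (real (Suc n)))"
    have s: "?s n \<in> closed_balls_pos" for n
      using c unfolding closed_balls_pos_def by force
    have "\<forall>\<^sub>F n in sequentially. ?s n \<in> closed_balls \<and> hausdorff_dist (?s n) B < e" if "0 < e" for e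
    proof -
      have "\<forall>\<^sub>F n in sequentially. inverse (real (Suc n)) < e"
        using LIMSEQ_inverse_real_of_nat \<open>0 < e\<close> by (rule order_tendstoD)
      then show ?thesis
      proof eventually_elim
        case (elim n)
        have "hausdorff_dist (?s n) B \<le> inverse (real (Suc n))"
          unfolding c(2) using c(1) by (intro hausdorff_dist_mcball_0_le) auto
        then show ?case
          using elim s closed_balls_pos_subset by fastforce
      qed
    qed
    then show ?thesis
      using s B unfolding H.limitin_metric by (intro exI[of _ ?s]) simp
  qed
  then show ?thesis
    unfolding H.dense_subset_def using closed_balls_pos_subset by blast
qed

text \<open>The disjunction on \<open>e\<close> rules out a ball with several points that are all
  very close together: \<open>mcball c 0\<close> could then be nearer than \<open>e\<close> and
  still differ from it.\<close>

lemma closed_ball_eqI_hausdorff: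
  assumes c: "c \<in> M" and r: "0 \<le> r" and B': "B' \<in> closed_balls" and "e \<le> r"
    and e: "(\<forall>x\<in>mcball c r. x = c) \<or> (\<exists>x\<in>mcball c r. \<exists>y\<in>mcball c r. e \<le> d x y)"
    and less: "hausdorff_dist (mcball c r) B' < e"
  shows "B' = mcball c r"
proof -
  have ul: "d x y < t" if "d x z < t" "d z y < t" "x \<in> M" "y \<in> M" "z \<in> M" for x y z t
    using ultrametric[of x y z] that by simp
  have ul_le: "d x y \<le> t" if "d x z \<le> t" "d z y \<le> t" "x \<in> M" "y \<in> M" "z \<in> M" for x y z t
    using ultrametric[of x y z] that by simp
  obtain c' s where s: "c' \<in> M" "0 \<le> s" "B' = mcball c' s"
    using B' unfolding closed_balls_def by blast
  have cb: "mcball c r \<in> closed_bounded_sets" "B' \<in> closed_bounded_sets"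
    using c r B' closed_balls_subset unfolding closed_balls_def by auto
  have fwd: "\<exists>y\<in>B'. d x y < e" if "x \<in> mcball c r" for x
    using hausdorff_dist_lessD[OF cb less that] by blast
  have bwd: "\<exists>x\<in>mcball c r. d y x < e" if "y \<in> B'" for y
    using hausdorff_dist_lessD[OF cb(2,1) _ that] less hausdorff_dist_commute by metis
  have sub: "B' \<subseteq> mcball c r"
  proof
    fix y assume y: "y \<in> B'"
    then obtain x where x: "x \<in> mcball c r" "d y x < e"
      using bwd by blast
    \<comment> \<open>Both \<open>d c x \<le> r\<close> and \<open>d x y < e \<le> r\<close> hold,
      so the maximum does not exceed \<open>r\<close>.\<close>
    then have "d c y \<le> r"
      using y s c \<open>e \<le> r\<close> by (intro ul_le[of c x r y]) (auto simp: commute)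
    then show "y \<in> mcball c r"
      using y s c by simp
  qed
  from e show ?thesis
  proof
    assume single: "\<forall>x\<in>mcball c r. x = c"
    have c': "c' \<in> B'"
      using s by simp
    with single sub have "c' = c"
      by blast
    with single have "mcball c r \<subseteq> {c'}"
      by blast
    with c' sub show ?thesis
      by blast
  next
    assume "\<exists>x\<in>mcball c r. \<exists>y\<in>mcball c r. e \<le> d x y"
    then obtain x y where xy: "x \<in> mcball c r" "y \<in> mcball c r" "e \<le> d x y"
      by blast
    obtain x' y' where x': "x' \<in> B'" "d x x' < e" and y': "y' \<in> B'" "d y y' < e"
      using fwd xy by blast
    have M: "x \<in> M" "y \<in> M" "x' \<in> M" "y' \<in> M"
      using xy x' y' s by auto
    \<comment> \<open>Otherwise the chain \<open>x\<close>, \<open>x'\<close>, \<open>y'\<close>,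
      \<open>y\<close> would have all its steps below \<open>e\<close>, forcing
      \<open>d x y < e\<close>.\<close>
    have "\<not> d x' y' < e"
      using ul[of x x' e y'] ul[of x y' e y] x' y' xy M by (auto simp: commute)
    moreover have "d x' y' \<le> s"
      using ul_le[of x' c' s y'] x' y' s by (auto simp: commute)
    ultimately have es: "e \<le> s"
      by simp
    have "b \<in> B'" if b: "b \<in> mcball c r" for b
    proof -
      obtain b' where b': "b' \<in> B'" "d b b' < e"
        using fwd b by blast
      \<comment> \<open>The detour through \<open>b'\<close> costs less than \<open>e\<close>, which
        \<open>es\<close> bounds by the radius \<open>s\<close>.\<close>
      then have "d c' b \<le> s"
        using b s es by (intro ul_le[of c' b' s b]) (auto simp: commute)
      then show ?thesis
        using b s by simp
    qed
    then show ?thesis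
      using sub by blast
  qed
qed

lemma closed_balls_pos_isolated:
  assumes "B \<in> closed_balls_pos"
  shows "\<exists>r>0. Metric_space.mcball closed_balls hausdorff_dist B r = {B}"
proof -
  interpret H: ultrametric_space closed_balls hausdorff_dist
    by (rule ultrametric_closed_balls)
  obtain c r where B: "B = mcball c r" "c \<in> M" "0 < r"
    using assms unfolding closed_balls_pos_def by blast
  obtain e where e: "0 < e" "e \<le> r"
    "(\<forall>x\<in>mcball c r. x = c) \<or> (\<exists>x\<in>mcball c r. \<exists>y\<in>mcball c r. e \<le> d x y)"
  proof (cases "\<forall>x\<in>mcball c r. x = c")
    case True
    then show thesis
      using that[of r] B by blast
  next
    case False
    then obtain x where x: "x \<in> mcball c r" "x \<noteq> c"
      by blast
    moreover from this have "0 < d x c"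
      using B by auto
    moreover have "c \<in> mcball c r"
      using B by simp
    \<comment> \<open>The pair \<open>x\<close>, \<open>c\<close> realises the required distance;
      the minimum with \<open>r\<close> keeps \<open>e \<le> r\<close>.\<close>
    ultimately show thesis
      using that[of "min r (d x c)"] B by (meson min.cobounded1 min.cobounded2 min_less_iff_conj)
  qed
  \<comment> \<open>Halving \<open>e\<close> turns the non-strict bound of a closed ball into the
    strict bound \<open>< e\<close>.\<close>
  have "B' = B" if "B' \<in> H.mcball B (e / 2)" for B'
    unfolding B(1)
    using that e B by (intro closed_ball_eqI_hausdorff[of c r B' e]) auto
  moreover have "B \<in> H.mcball B (e / 2)"
    using assms closed_balls_pos_subset e by auto
  ultimately have "H.mcball B (e / 2) = {B}"
    by blast
  then show ?thesis
    using e(1) half_gt_zero by blast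
qed

end

theorem proposition4p14:
  fixes X :: "'a set" and d :: "'a \<Rightarrow> 'a \<Rightarrow> real"
  assumes "ultrametric_space X d"
  shows "Metric_space.dense_subset (Metric_space.closed_balls X d) (Metric_space.hausdorff_dist X d)
           (Metric_space.closed_balls_pos X d) \<and>
         Metric_space.discrete_subset (Metric_space.closed_balls X d) (Metric_space.hausdorff_dist X d)
           (Metric_space.closed_balls_pos X d) \<and>
         (\<forall>S. Metric_space.dense_subset (Metric_space.closed_balls X d) (Metric_space.hausdorff_dist X d) S \<and>
              Metric_space.discrete_subset (Metric_space.closed_balls X d) (Metric_space.hausdorff_dist X d) S
              \<longrightarrow> S = Metric_space.closed_balls_pos X d)"
proof -
  interpret ultrametric_space X d
    by (rule assms)
  interpret H: ultrametric_space closed_balls hausdorff_dist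
    by (rule ultrametric_closed_balls)
  show ?thesis
    using closed_balls_pos_dense
      H.dense_isolated_imp_unique_dense_discrete[OF closed_balls_pos_dense closed_balls_pos_isolated]
    by blast
qed

end
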